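(* Let $F:\Omega\times I\to\Omega\times I$, $F(\omega,x)=(\tau(\omega),f_\omega(x))$, be a skew product, where $\tau:\Omega\to\Omega$ is an ergodic measure-preserving transformation of a standard probability space $(\Omega,\mathscr F,\mathbb P)$ and the fiber maps $f_\omega:I\to I$ are measurable. Assume that $\mathbb P\times\mathrm{Leb}$ is ergodic with respect to $F$ and that there exist constants $\gamma_0,\gamma_1\in(0,1)$ with $\gamma_0<\gamma_1$ and sets $B_0,B_1\subset I$ of positive Lebesgue measure such that for every $x_0\in B_0$ and $x_1\in B_1$, $$\limsup_{n\to\infty}\frac1n\sum_{j=0}^{n-1}\mathbf 1_{I_i(\gamma_i)}(f^j_\omega(x_i))=1\quad\text{for }\mathbb P\text{-a.e. }\omega\in\Omega,\quad i=0,1.$$ Then $$\liminf_{n\to\infty}\frac1n\sum_{j=0}^{n-1}f^j_\omega(x)\le\gamma_0\quad\text{and}\quad\gamma_1\le\limsup_{n\to\infty}\frac1n\sum_{j=0}^{n-1}f^j_\omega(x)$$ for $(\mathbb P\times\mathrm{Leb})$-a.e. $(\omega,x)\in\Omega\times I$. In particular, $F$ has historical behavior for $(\mathbb P\times\mathrm{Leb})$-a.e. point.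
   Context: $I=[0,1]$ with Lebesgue measure $\mathrm{Leb}$; $I_0(\gamma)=[0,\gamma]$ and $I_1(\gamma)=[\gamma,1]$. $f^0_\omega=\mathrm{id}$ and $f^n_\omega=f_{\tau^{n-1}(\omega)}\circ\dots\circ f_\omega$ for $n\ge1$. Ergodicity of the (not necessarily $F$-invariant) probability $\mu=\mathbb P\times\mathrm{Leb}$: $\mu(A)\in\{0,1\}$ for every measurable set $A$ such that $F(A)\subset A$. Historical behavior for $(\mathbb P\times\mathrm{Leb})$-a.e. point: for $(\mathbb P\times\mathrm{Leb})$-a.e. $(\omega,x)$ there is a continuous $\varphi:I\to\mathbb R$ such that $\lim_{n\to\infty}\frac1n\sum_{j=0}^{n-1}\varphi(f^j_\omega(x))$ does not exist.
   Formalization: The skew product F itself is assumed measurable on the product space, that is, (ω,x) ↦ f_ω(x) is jointly measurable; with only each fiber map f_ω measurable the claim can fail (under the continuum hypothesis). *)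

theory Defs
  imports "HOL-Probability.Probability"
begin

text \<open>
  The condition below is implied by each of the usual conventions for a standard probability
  space: a Polish space with its Borel sets, the completion of such a space, and a
  Lebesgue--Rokhlin space. The last convention is the reason for allowing the Polish topology
  to live on a set of full measure only; the final conjunct says that every measurable subset
  of that set agrees with a Borel set up to a Borel null set.
\<close>

definition standard_probability_space :: "'a measure \<Rightarrow> bool" where
  "standard_probability_space M \<longleftrightarrow>
     prob_space M \<and>
     (\<exists>X. completely_metrizable_space X \<and> second_countable X \<and>
          topspace X \<in> sets M \<and> measure M (topspace X) = 1 \<and>
          (let \<B> = sigma_sets (topspace X) {U. openin X U} in
             \<B> \<subseteq> sets M \<and>
             (\<forall>A\<in>sets M. A \<subseteq> topspace X \<longrightarrow>
                (\<exists>B\<in>\<B>. \<exists>C\<in>\<B>. B \<subseteq> A \<and> A \<subseteq> C \<and> measure M (C - B) = 0))))"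

definition measure_preserving :: "'a measure \<Rightarrow> ('a \<Rightarrow> 'a) \<Rightarrow> bool" where
  "measure_preserving M T \<longleftrightarrow> T \<in> measurable M M \<and> distr M M T = M"

text \<open>
  Invariance of the measure is not assumed. If \<open>T\<close> preserves the probability \<open>M\<close>, forward
  invariant sets agree almost everywhere with their preimages, so this is then the
  usual ergodicity.
\<close>

definition ergodic :: "'a measure \<Rightarrow> ('a \<Rightarrow> 'a) \<Rightarrow> bool" where
  "ergodic M T \<longleftrightarrow> (\<forall>A\<in>sets M. T ` A \<subseteq> A \<longrightarrow> measure M A \<in> {0, 1})"

definition Leb :: "real measure" where
  "Leb = restrict_space lborel {0..1}"

definition skew_product :: "('a \<Rightarrow> 'a) \<Rightarrow> ('a \<Rightarrow> real \<Rightarrow> real) \<Rightarrow> 'a \<times> real \<Rightarrow> 'a \<times> real" where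
  "skew_product \<tau> f = (\<lambda>(\<omega>, x). (\<tau> \<omega>, f \<omega> x))"

primrec fiber_iter :: "('a \<Rightarrow> 'a) \<Rightarrow> ('a \<Rightarrow> real \<Rightarrow> real) \<Rightarrow> nat \<Rightarrow> 'a \<Rightarrow> real \<Rightarrow> real" where
  "fiber_iter \<tau> f 0 \<omega> x = x"
| "fiber_iter \<tau> f (Suc n) \<omega> x = f ((\<tau> ^^ n) \<omega>) (fiber_iter \<tau> f n \<omega> x)"

definition fiber_average ::
  "('a \<Rightarrow> 'a) \<Rightarrow> ('a \<Rightarrow> real \<Rightarrow> real) \<Rightarrow> (real \<Rightarrow> real) \<Rightarrow> 'a \<Rightarrow> real \<Rightarrow> nat \<Rightarrow> real" where
  "fiber_average \<tau> f \<phi> \<omega> x n = (1 / real n) * (\<Sum>j<n. \<phi> (fiber_iter \<tau> f j \<omega> x))"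

definition historical_behavior_ae ::
  "'a measure \<Rightarrow> ('a \<Rightarrow> 'a) \<Rightarrow> ('a \<Rightarrow> real \<Rightarrow> real) \<Rightarrow> bool" where
  "historical_behavior_ae M \<tau> f \<longleftrightarrow>
     (AE (\<omega>, x) in M \<Otimes>\<^sub>M Leb.
        \<exists>\<phi>. continuous_on {0..1} \<phi> \<and> \<not> convergent (fiber_average \<tau> f \<phi> \<omega> x))"

end

theory Submission
  imports Defs
begin

text \<open>
  Write \<open>F\<close> for the skew product. The upper and lower averages of a bounded observable do not
  change when the first point of an orbit is dropped, so the set of points whose upper average is
  at least \<open>\<gamma>\<^sub>1\<close> and the set of points whose lower average is at most \<open>\<gamma>\<^sub>0\<close> are mapped
  into themselves by \<open>F\<close> (\<open>limsup_average_shift\<close>). By ergodicity each has measure 0 or 1, and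
  it remains to exclude measure 0.

  An orbit that spends almost all of a long time window in \<open>[\<gamma>\<^sub>1, 1]\<close> has an average over that
  window of almost \<open>\<gamma>\<^sub>1\<close> or more, because the rest of the orbit contributes at least 0. Hence the
  first set contains \<open>(\<omega>, x)\<close> for every \<open>x \<in> B\<^sub>1\<close> and almost every \<open>\<omega>\<close>, and if
  it were null then by Fubini \<open>B\<^sub>1\<close> would be null. The same argument, applied to the observable
  \<open>-y\<close>, handles the lower average with \<open>[0, \<gamma>\<^sub>0]\<close> and \<open>B\<^sub>0\<close>; the lemma
  \<open>AE_limsup_ge_of_visits\<close> is stated for a bounded observable so as to cover both cases.
  Since \<open>\<gamma>\<^sub>0 < \<gamma>\<^sub>1\<close>, the averages of the identity observable oscillate almost everywhere,
  and this single observable witnesses historical behavior.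
\<close>

definition birkhoff_average :: "('b \<Rightarrow> 'b) \<Rightarrow> ('b \<Rightarrow> real) \<Rightarrow> 'b \<Rightarrow> nat \<Rightarrow> real" where
  "birkhoff_average T h z n = (1 / real n) * (\<Sum>j<n. h ((T ^^ j) z))"

lemma funpow_in_space:
  assumes "T \<in> measurable M M" "z \<in> space M"
  shows "(T ^^ n) z \<in> space M"
  using assms by (induction n) (auto dest: measurable_space)

lemma funpow_measurable:
  assumes "T \<in> measurable M M"
  shows "T ^^ n \<in> measurable M M"
  by (induction n) (auto intro: measurable_compose[OF _ assms])

lemma birkhoff_average_measurable:
  assumes "T \<in> measurable M M" "h \<in> borel_measurable M"
  shows "(\<lambda>z. birkhoff_average T h z n) \<in> borel_measurable M"
proof -
  have "(\<lambda>z. h ((T ^^ j) z)) \<in> borel_measurable M" for j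
    using measurable_comp[OF funpow_measurable[OF assms(1)] assms(2)] by (simp add: comp_def)
  then show ?thesis
    unfolding birkhoff_average_def by measurable
qed

text \<open>
  The sums over \<open>n\<close> steps started at \<open>z\<close> and at \<open>T z\<close> differ only in their two end terms, so the
  averages differ by at most \<open>2 K / n\<close>.
\<close>

lemma limsup_average_shift:
  assumes "T \<in> measurable M M" "z \<in> space M"
    and bounded: "\<And>y. y \<in> space M \<Longrightarrow> \<bar>h y\<bar> \<le> K"
  shows "limsup (\<lambda>n. ereal (birkhoff_average T h (T z) n))
       = limsup (\<lambda>n. ereal (birkhoff_average T h z n))"
proof -
  let ?d = "\<lambda>n. (h ((T ^^ n) z) - h z) / real n"
  have shift: "(T ^^ j) (T z) = (T ^^ Suc j) z" for j
    by (simp add: funpow_swap1)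
  have telescope: "(\<Sum>j<n. h ((T ^^ j) (T z))) = (h ((T ^^ n) z) - h z) + (\<Sum>j<n. h ((T ^^ j) z))" for n
    unfolding shift by (induction n) auto
  have "\<bar>h ((T ^^ n) z) - h z\<bar> \<le> 2 * K" for n
    using bounded[OF funpow_in_space[OF assms(1,2), of n]] bounded[OF assms(2)] by linarith
  then have "norm (?d n) \<le> 2 * K / real n" for n
    by (simp add: divide_right_mono)
  then have "?d \<longlonglongrightarrow> 0"
    by (intro Lim_null_comparison[OF _ lim_const_over_n[of "2 * K"]]) simp
  then have "(\<lambda>n. ereal (?d n)) \<longlonglongrightarrow> ereal 0"
    by (rule tendsto_ereal)
  from ereal_limsup_lim_add[OF this, of "\<lambda>n. ereal (birkhoff_average T h z n)"]
  show ?thesis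
    by (simp add: birkhoff_average_def telescope add_divide_distrib zero_ereal_def[symmetric])
qed

lemma ergodic_limsup_zero_one:
  fixes c :: ereal
  assumes T: "T \<in> measurable M M" and "ergodic M T" and h: "h \<in> borel_measurable M"
    and bounded: "\<And>y. y \<in> space M \<Longrightarrow> \<bar>h y\<bar> \<le> K"
  defines "A \<equiv> {z \<in> space M. c \<le> limsup (\<lambda>n. ereal (birkhoff_average T h z n))}"
  shows "A \<in> sets M" and "measure M A \<in> {0, 1}"
proof -
  have [measurable]: "(\<lambda>z. birkhoff_average T h z n) \<in> borel_measurable M" for n
    by (rule birkhoff_average_measurable[OF T h])
  show "A \<in> sets M"
    unfolding A_def by measurable
  moreover have "T ` A \<subseteq> A"
    using limsup_average_shift[of T M _ h, OF T _ bounded] measurable_space[OF T]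
    by (auto simp: A_def)
  ultimately show "measure M A \<in> {0, 1}"
    using \<open>ergodic M T\<close> by (auto simp: ergodic_def)
qed

lemma skew_product_funpow:
  "(skew_product \<tau> f ^^ n) (\<omega>, x) = ((\<tau> ^^ n) \<omega>, fiber_iter \<tau> f n \<omega> x)"
  by (induction n) (auto simp: skew_product_def)

lemma fiber_average_eq_birkhoff:
  "fiber_average \<tau> f g \<omega> x = birkhoff_average (skew_product \<tau> f) (\<lambda>z. g (snd z)) (\<omega>, x)"
  by (simp add: fun_eq_iff fiber_average_def birkhoff_average_def skew_product_funpow)

text \<open>
  Bounding the observable below by \<open>c\<close> on \<open>J\<close> and by \<open>-K\<close> elsewhere, an average in which the
  fraction \<open>p\<close> of the time is spent in \<open>J\<close> is at least \<open>(c + K) p - K\<close>, which tends to \<open>c\<close> as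
  \<open>p\<close> tends to 1.
\<close>

lemma limsup_average_ge_of_visits:
  fixes g :: "real \<Rightarrow> real"
  assumes visits: "limsup (\<lambda>n. ereal (fiber_average \<tau> f (indicator J) \<omega> x n)) = 1"
    and orbit: "\<And>n. fiber_iter \<tau> f n \<omega> x \<in> S"
    and on_J: "\<And>y. y \<in> J \<Longrightarrow> c \<le> g y"
    and bounded: "\<And>y. y \<in> S \<Longrightarrow> \<bar>g y\<bar> \<le> K"
    and "- K \<le> c"
  shows "ereal c \<le> limsup (\<lambda>n. ereal (fiber_average \<tau> f g \<omega> x n))"
proof -
  let ?p = "fiber_average \<tau> f (indicator J) \<omega> x" and ?a = "fiber_average \<tau> f g \<omega> x"
  have pointwise: "(c + K) * indicator J y - K \<le> g y" if "y \<in> S" for y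
    using on_J[of y] bounded[OF that] by (auto simp: indicator_def abs_le_iff)
  have lower: "(c + K) * ?p n - K \<le> ?a n" if "n > 0" for n
  proof -
    have "(\<Sum>j<n. (c + K) * indicator J (fiber_iter \<tau> f j \<omega> x) - K)
        \<le> (\<Sum>j<n. g (fiber_iter \<tau> f j \<omega> x))"
      by (intro sum_mono pointwise orbit)
    then have "(c + K) * (\<Sum>j<n. indicator J (fiber_iter \<tau> f j \<omega> x)) - real n * K
        \<le> (\<Sum>j<n. g (fiber_iter \<tau> f j \<omega> x))"
      by (simp add: sum_subtractf sum_distrib_left)
    from divide_right_mono[OF this, of "real n"] that show ?thesis
      by (simp add: fiber_average_def diff_divide_distrib)
  qed
  have "ereal c = ereal (c + K) * 1 + ereal (- K)"
    by (simp add: one_ereal_def)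
  also have "\<dots> = limsup (\<lambda>n. ereal (c + K) * ereal (?p n)) + ereal (- K)"
    using visits \<open>- K \<le> c\<close> by (subst Limsup_ereal_mult_left) auto
  also have "\<dots> = limsup (\<lambda>n. ereal (- K) + ereal (c + K) * ereal (?p n))"
    by (subst ereal_limsup_lim_add[OF tendsto_const]) (auto simp: add.commute)
  also have "\<dots> \<le> limsup (\<lambda>n. ereal (?a n))"
    using lower by (intro Limsup_mono eventually_sequentiallyI[of 1]) (auto simp: algebra_simps)
  finally show ?thesis .
qed

lemma space_Leb [simp]: "space Leb = {0..1}"
  by (simp add: Leb_def space_restrict_space)

lemma prob_space_Leb: "prob_space Leb"
  unfolding Leb_def
  by (intro prob_spaceI) (simp add: space_restrict_space emeasure_restrict_space)

lemma borel_measurable_Leb: "g \<in> borel_measurable borel \<Longrightarrow> g \<in> borel_measurable Leb"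
  unfolding Leb_def by (simp add: measurable_restrict_space1)

text \<open>
  The zero-one alternative leaves only the null case to exclude. There, Fubini
  gives that for almost every \<open>x\<close> almost every \<open>\<omega>\<close> fails the bound; since the
  points of \<open>B\<close> satisfy it for almost every \<open>\<omega>\<close>, almost every \<open>x\<close> is outside \<open>B\<close>.
\<close>

lemma AE_limsup_ge_of_visits:
  fixes g :: "real \<Rightarrow> real"
  assumes "prob_space P"
    and F: "skew_product \<tau> f \<in> measurable (P \<Otimes>\<^sub>M Leb) (P \<Otimes>\<^sub>M Leb)"
    and erg: "ergodic (P \<Otimes>\<^sub>M Leb) (skew_product \<tau> f)"
    and B: "B \<subseteq> {0..1}" "B \<in> sets lebesgue" "emeasure lebesgue B > 0"
    and visits: "\<And>x. x \<in> B \<Longrightarrow>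
      AE \<omega> in P. limsup (\<lambda>n. ereal (fiber_average \<tau> f (indicator J) \<omega> x n)) = 1"
    and g: "g \<in> borel_measurable borel"
    and on_J: "\<And>y. y \<in> J \<Longrightarrow> c \<le> g y"
    and bounded: "\<And>y. y \<in> {0..1} \<Longrightarrow> \<bar>g y\<bar> \<le> K"
    and "- K \<le> c"
  shows "AE (\<omega>, x) in P \<Otimes>\<^sub>M Leb. ereal c \<le> limsup (\<lambda>n. ereal (fiber_average \<tau> f g \<omega> x n))"
proof -
  interpret P: prob_space P by fact
  interpret L: prob_space Leb by (rule prob_space_Leb)
  interpret N: pair_prob_space P Leb ..
  let ?N = "P \<Otimes>\<^sub>M Leb" and ?F = "skew_product \<tau> f"
  let ?Q = "\<lambda>\<omega> x. ereal c \<le> limsup (\<lambda>n. ereal (fiber_average \<tau> f g \<omega> x n))"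
  define A where "A = {z \<in> space ?N. ereal c \<le> limsup (\<lambda>n. ereal (birkhoff_average ?F (\<lambda>z. g (snd z)) z n))}"
  have obs: "(\<lambda>z. g (snd z)) \<in> borel_measurable ?N"
    using measurable_comp[OF measurable_snd borel_measurable_Leb[OF g]] by (simp add: comp_def)
  have bd: "\<bar>g (snd z)\<bar> \<le> K" if "z \<in> space ?N" for z
    using that by (intro bounded) (auto simp: space_pair_measure)
  note zero_one = ergodic_limsup_zero_one[of ?F ?N "\<lambda>z. g (snd z)" K "ereal c", OF F erg obs bd, folded A_def]
  have A_iff: "(\<omega>, x) \<in> A \<longleftrightarrow> \<omega> \<in> space P \<and> x \<in> {0..1} \<and> ?Q \<omega> x" for \<omega> x
    by (auto simp: A_def space_pair_measure fiber_average_eq_birkhoff)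
  have orbit: "fiber_iter \<tau> f n \<omega> x \<in> {0..1}" if "\<omega> \<in> space P" "x \<in> {0..1}" for n \<omega> x
    using funpow_in_space[OF F, of "(\<omega>, x)" n] that
    by (auto simp: space_pair_measure skew_product_funpow)
  have good_section: "AE \<omega> in P. (\<omega>, x) \<in> A" if "x \<in> B" for x
    using visits[OF that] AE_space[of P]
  proof eventually_elim
    case (elim \<omega>)
    have x: "x \<in> {0..1}" using that B by auto
    have "?Q \<omega> x"
      using elim(1) orbit[OF elim(2) x] on_J bounded \<open>- K \<le> c\<close>
      by (rule limsup_average_ge_of_visits)
    with elim x show ?case by (simp add: A_iff)
  qed
  have "measure ?N A \<noteq> 0"
  proof
    assume "measure ?N A = 0"
    then have "A \<in> null_sets ?N"
      using zero_one(1) by (auto simp: null_sets_def N.emeasure_eq_measure)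
    then have "AE z in ?N. z \<notin> A"
      by (rule AE_not_in)
    then have "AE \<omega> in P. AE x in Leb. (\<omega>, x) \<notin> A"
      using N.AE_pair by fastforce
    moreover have "{z \<in> space ?N. (fst z, snd z) \<notin> A} \<in> sets ?N"
      using zero_one(1) by simp
    ultimately have "AE x in Leb. AE \<omega> in P. (\<omega>, x) \<notin> A"
      by (subst (asm) N.AE_commute) auto
    then have "AE x in lborel. x \<in> {0..1} \<longrightarrow> (AE \<omega> in P. (\<omega>, x) \<notin> A)"
      unfolding Leb_def by (subst (asm) AE_restrict_space_iff) auto
    then have "AE x in lborel. x \<notin> B"
    proof eventually_elim
      case (elim x)
      show ?case
      proof
        assume "x \<in> B"
        with elim B have "AE \<omega> in P. (\<omega>, x) \<notin> A" by auto
        with good_section[OF \<open>x \<in> B\<close>] have "AE \<omega> in P. False" by eventually_elim simp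
        then show False by simp
      qed
    qed
    then have "AE x in lebesgue. x \<notin> B"
      by (rule AE_completion)
    then have "emeasure lebesgue B = 0"
      using B(2) by (subst (asm) AE_iff_measurable[of B]) auto
    with B(3) show False by simp
  qed
  with zero_one(2) have "measure ?N A = 1" by auto
  then have "AE z in ?N. z \<in> A"
    using zero_one(1) by (simp add: N.prob_eq_1)
  then show ?thesis
    by eventually_elim (auto simp: A_iff)
qed

text \<open>
  The lower average of the identity is controlled through the upper average of \<open>-y\<close>; the
  bound 1 for both observables on the unit interval satisfies \<open>-1 \<le> -\<gamma>\<^sub>0\<close> and
  \<open>-1 \<le> \<gamma>\<^sub>1\<close>.
\<close>

theorem theorem6p1:
  fixes P :: "'a measure"
    and \<tau> :: "'a \<Rightarrow> 'a"
    and f :: "'a \<Rightarrow> real \<Rightarrow> real"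
    and \<gamma>0 \<gamma>1 :: real
    and B0 B1 :: "real set"
  assumes "standard_probability_space P"
    and "measure_preserving P \<tau>"
    and "ergodic P \<tau>"
    and "\<And>\<omega>. \<omega> \<in> space P \<Longrightarrow> f \<omega> \<in> measurable Leb Leb"
    and "skew_product \<tau> f \<in> measurable (P \<Otimes>\<^sub>M Leb) (P \<Otimes>\<^sub>M Leb)"
    and "ergodic (P \<Otimes>\<^sub>M Leb) (skew_product \<tau> f)"
    and "\<gamma>0 \<in> {0<..<1}" and "\<gamma>1 \<in> {0<..<1}" and "\<gamma>0 < \<gamma>1"
    and "B0 \<subseteq> {0..1}" and "B0 \<in> sets lebesgue" and "emeasure lebesgue B0 > 0"
    and "B1 \<subseteq> {0..1}" and "B1 \<in> sets lebesgue" and "emeasure lebesgue B1 > 0"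
    and "\<And>x0. x0 \<in> B0 \<Longrightarrow>
           AE \<omega> in P. limsup (\<lambda>n. ereal (fiber_average \<tau> f (indicator {0..\<gamma>0}) \<omega> x0 n)) = 1"
    and "\<And>x1. x1 \<in> B1 \<Longrightarrow>
           AE \<omega> in P. limsup (\<lambda>n. ereal (fiber_average \<tau> f (indicator {\<gamma>1..1}) \<omega> x1 n)) = 1"
  shows "(AE (\<omega>, x) in P \<Otimes>\<^sub>M Leb.
            liminf (\<lambda>n. ereal (fiber_average \<tau> f (\<lambda>y. y) \<omega> x n)) \<le> ereal \<gamma>0 \<and>
            ereal \<gamma>1 \<le> limsup (\<lambda>n. ereal (fiber_average \<tau> f (\<lambda>y. y) \<omega> x n)))
         \<and> historical_behavior_ae P \<tau> f"
proof -
  let ?N = "P \<Otimes>\<^sub>M Leb" and ?a = "fiber_average \<tau> f (\<lambda>y. y)"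
  have P: "prob_space P"
    using assms(1) by (simp add: standard_probability_space_def)
  have lower: "AE (\<omega>, x) in ?N. ereal (- \<gamma>0) \<le> limsup (\<lambda>n. ereal (fiber_average \<tau> f uminus \<omega> x n))"
    using P assms(5,6,10-12,16)
    by (rule AE_limsup_ge_of_visits[where K = 1]) (use assms(7) in auto)
  have upper: "AE (\<omega>, x) in ?N. ereal \<gamma>1 \<le> limsup (\<lambda>n. ereal (?a \<omega> x n))"
    using P assms(5,6,13-15,17)
    by (rule AE_limsup_ge_of_visits[where K = 1]) (use assms(8) in auto)
  have limsup_uminus: "limsup (\<lambda>n. ereal (fiber_average \<tau> f uminus \<omega> x n)) = - liminf (\<lambda>n. ereal (?a \<omega> x n))"
    for \<omega> x
    using ereal_Limsup_uminus[of sequentially "\<lambda>n. ereal (?a \<omega> x n)"]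
    by (simp add: fiber_average_def sum_negf)
  have oscillation: "AE (\<omega>, x) in ?N. liminf (\<lambda>n. ereal (?a \<omega> x n)) \<le> ereal \<gamma>0 \<and>
      ereal \<gamma>1 \<le> limsup (\<lambda>n. ereal (?a \<omega> x n))"
    using lower upper
    by eventually_elim (auto simp: limsup_uminus simp flip: uminus_ereal.simps(1))
  have divergent: "\<not> convergent (?a \<omega> x)"
    if "liminf (\<lambda>n. ereal (?a \<omega> x n)) \<le> ereal \<gamma>0" "ereal \<gamma>1 \<le> limsup (\<lambda>n. ereal (?a \<omega> x n))" for \<omega> x
  proof
    assume "convergent (?a \<omega> x)"
    then obtain l where "?a \<omega> x \<longlonglongrightarrow> l" by (auto simp: convergent_def)
    then have "(\<lambda>n. ereal (?a \<omega> x n)) \<longlonglongrightarrow> ereal l" by (rule tendsto_ereal)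
    then have "liminf (\<lambda>n. ereal (?a \<omega> x n)) = ereal l" "limsup (\<lambda>n. ereal (?a \<omega> x n)) = ereal l"
      by (auto intro: lim_imp_Liminf lim_imp_Limsup)
    with that \<open>\<gamma>0 < \<gamma>1\<close> show False by simp
  qed
  have "historical_behavior_ae P \<tau> f"
    unfolding historical_behavior_ae_def using oscillation
    by eventually_elim (auto intro!: exI[of _ "\<lambda>y. y"] dest: divergent)
  with oscillation show ?thesis by blast
qed

end
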